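(* Let $\mathcal{D}_{\mathrm{cal}}=\{(\boldsymbol{x}_i,y_i)\}_{i=1}^n$ be the clean calibration set, let $s:\mathcal{X}\times\mathcal{Y}\to\mathbb{R}$ be a score function, let $\alpha\in(0,1)$, and let $0\le k\le n$ be an integer. Let $\tilde{\mathcal{D}}_{\mathrm{cal}}=\{(\boldsymbol{x}_i,\tilde{y}_i)\}_{i=1}^n$ be any (possibly random, adversarially chosen) label-poisoned calibration set, with $\tilde y_i\in\mathcal{Y}$ and $\tilde{y}_i\ne y_i$ for at most $k$ indices $i$. Let $\underline{q_\alpha}$ be the optimal value of $$\min_{z_1,\dots,z_n\in\mathcal{Y}}\ \mathrm{Quant}\left(\alpha;\{s(\boldsymbol{x}_i,z_i)\}_{i=1}^n\right)\quad\text{s.t.}\quad\sum_{i=1}^n\mathbf{1}[z_i\ne\tilde{y}_i]\le k .$$ Define $\overline{\mathcal{C}}_\alpha(\boldsymbol{x})=\{y\in\mathcal{Y}:s(\boldsymbol{x},y)\ge\underline{q_\alpha}\}$. Then for any $(\boldsymbol{x}_{n+1},y_{n+1})$ exchangeable with the clean calibration set $\mathcal{D}_{\mathrm{cal}}$, $$\Pr\left[y_{n+1}\in\overline{\mathcal{C}}_\alpha(\boldsymbol{x}_{n+1})\right]\ge1-\alpha.$$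
   Context: $\mathcal{X}$ is the input space and $\mathcal{Y}$ is a finite label set. All functions and random elements are assumed measurable as needed. "$(\boldsymbol{x}_{n+1},y_{n+1})$ exchangeable with $\mathcal{D}_{\mathrm{cal}}$" means that $(\boldsymbol{x}_1,y_1),\dots,(\boldsymbol{x}_{n+1},y_{n+1})$ are exchangeable random elements of $\mathcal{X}\times\mathcal{Y}$. Quantile convention: for a finite family $A$ of $n$ real numbers and $\tau\in(0,1)$, $\mathrm{Quant}(\tau;A)$ is the $\lfloor\tau(n+1)\rfloor$-th smallest element of $A$ (counted with multiplicity), and $-\infty$ if $\lfloor\tau(n+1)\rfloor=0$. *)

theory Defs
  imports
    "HOL-Probability.Probability"
    "HOL-Library.Multiset"
    "HOL-Combinatorics.Permutations"
begin

text \<open>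
  For a finite index set: the random elements \<open>Z i\<close> take values in the measurable space \<open>S\<close>, and
  permuting the indices does not change their joint law on the product space.
\<close>

definition exchangeable :: "'w measure \<Rightarrow> 'i set \<Rightarrow> 'a measure \<Rightarrow> ('i \<Rightarrow> 'w \<Rightarrow> 'a) \<Rightarrow> bool" where
  "exchangeable M I S Z \<longleftrightarrow>
     (\<forall>i\<in>I. Z i \<in> M \<rightarrow>\<^sub>M S) \<and>
     (\<forall>\<pi>. \<pi> permutes I \<longrightarrow>
        distr M (PiM I (\<lambda>_. S)) (\<lambda>\<omega>. \<lambda>i\<in>I. Z (\<pi> i) \<omega>) =
        distr M (PiM I (\<lambda>_. S)) (\<lambda>\<omega>. \<lambda>i\<in>I. Z i \<omega>))"

text \<open>
  List positions start at 0, so the \<open>r\<close>-th smallest element sits at position \<open>r - 1\<close>. For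
  \<open>0 < \<tau> < 1\<close> the rank \<open>r\<close> is at most \<open>size A\<close>; other values of \<open>\<tau>\<close> are not meaningful.
\<close>

definition Quant :: "real \<Rightarrow> real multiset \<Rightarrow> ereal" where
  "Quant \<tau> A =
     (let r = nat \<lfloor>\<tau> * (real (size A) + 1)\<rfloor>
      in if r = 0 then -\<infinity> else ereal (sorted_list_of_multiset A ! (r - 1)))"

definition scores :: "('x \<times> 'y \<Rightarrow> real) \<Rightarrow> nat \<Rightarrow> (nat \<Rightarrow> 'x) \<Rightarrow> (nat \<Rightarrow> 'y) \<Rightarrow> real multiset" where
  "scores s n x z = image_mset (\<lambda>i. s (x i, z i)) (mset_set {1..n})"

text \<open>
  Extensional functions represent the tuples \<open>(z\<^sub>1, \<dots>, z\<^sub>n)\<close>, so for finite \<open>Y\<close> the feasible set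
  is finite; it contains \<open>yt\<close> (restricted to \<open>{1..n}\<close>) when \<open>yt\<close> is \<open>Y\<close>-valued. Hence the minimum
  below is attained.
\<close>

definition feasible_labels :: "'y set \<Rightarrow> nat \<Rightarrow> nat \<Rightarrow> (nat \<Rightarrow> 'y) \<Rightarrow> (nat \<Rightarrow> 'y) set" where
  "feasible_labels Y n k yt =
     {z \<in> {1..n} \<rightarrow>\<^sub>E Y. (\<Sum>i=1..n. of_bool (z i \<noteq> yt i)) \<le> k}"

definition q_lower ::
  "('x \<times> 'y \<Rightarrow> real) \<Rightarrow> 'y set \<Rightarrow> real \<Rightarrow> nat \<Rightarrow> nat \<Rightarrow> (nat \<Rightarrow> 'x) \<Rightarrow> (nat \<Rightarrow> 'y) \<Rightarrow> ereal" where
  "q_lower s Y \<alpha> n k x yt =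
     Min ((\<lambda>z. Quant \<alpha> (scores s n x z)) ` feasible_labels Y n k yt)"

definition prediction_set :: "('x \<times> 'y \<Rightarrow> real) \<Rightarrow> 'y set \<Rightarrow> ereal \<Rightarrow> 'x \<Rightarrow> 'y set" where
  "prediction_set s Y q x = {y \<in> Y. ereal (s (x, y)) \<ge> q}"

end

theory Submission
  imports Defs
begin

text \<open>
  The clean labels are feasible almost surely, so it suffices that with probability at least
  \<open>1 - \<alpha>\<close> at least \<open>r = \<lfloor>\<alpha> (n + 1)\<rfloor>\<close> of the \<open>n\<close> clean calibration scores are at most the test
  score. Otherwise the test score has rank at most \<open>r\<close> among all \<open>n + 1\<close> clean scores. At most
  \<open>r\<close> indices can have rank at most \<open>r\<close>, and by exchangeability all indices are equally likely
  to, so the failure probability is at most \<open>r / (n + 1) \<le> \<alpha>\<close>.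
\<close>

section \<open>Ranks and order statistics\<close>

text \<open>Among the indices of rank at most \<open>r\<close>, take one with the largest value: all
  the others lie below it, so its own rank already counts every one of them. Ties count in full and
  only raise ranks.\<close>

lemma card_rank_le:
  fixes f :: "'i \<Rightarrow> 'a::linorder"
  assumes "finite I"
  shows "card {j\<in>I. card {i\<in>I. f i \<le> f j} \<le> r} \<le> r"
proof (cases "{j\<in>I. card {i\<in>I. f i \<le> f j} \<le> r} = {}")
  case False
  let ?J = "{j\<in>I. card {i\<in>I. f i \<le> f j} \<le> r}"
  have "finite ?J" using assms by simp
  then have "Max (f ` ?J) \<in> f ` ?J" using False by (intro Max_in) auto
  then obtain m where m: "m \<in> ?J" "f m = Max (f ` ?J)" by auto
  have "?J \<subseteq> {i\<in>I. f i \<le> f m}"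
    using m(2) \<open>finite ?J\<close> by auto
  then have "card ?J \<le> card {i\<in>I. f i \<le> f m}"
    using assms by (intro card_mono) auto
  also have "\<dots> \<le> r" using m(1) by simp
  finally show ?thesis .
qed (simp only: card.empty)

text \<open>In a sorted list the entries at most \<open>t\<close> form an initial segment, so
  position \<open>m\<close> belongs to it exactly when its length is at least
  \<open>m + 1\<close>.\<close>

lemma sorted_nth_le_iff:
  fixes xs :: "'a::linorder list"
  assumes "sorted xs" "m < length xs"
  shows "xs ! m \<le> t \<longleftrightarrow> Suc m \<le> length (filter (\<lambda>a. a \<le> t) xs)"
proof -
  have len: "length (filter (\<lambda>a. a \<le> t) xs) = card {i. i < length xs \<and> xs ! i \<le> t}"
    by (simp add: length_filter_conv_card)
  show ?thesis
  proof
    assume "xs ! m \<le> t"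
    then have "{..m} \<subseteq> {i. i < length xs \<and> xs ! i \<le> t}"
      using assms by (auto intro: order_trans[OF sorted_nth_mono])
    then have "card {..m} \<le> card {i. i < length xs \<and> xs ! i \<le> t}"
      by (intro card_mono) auto
    then show "Suc m \<le> length (filter (\<lambda>a. a \<le> t) xs)"
      using len by simp
  next
    assume *: "Suc m \<le> length (filter (\<lambda>a. a \<le> t) xs)"
    show "xs ! m \<le> t"
    proof (rule ccontr)
      assume "\<not> xs ! m \<le> t"
      then have "{i. i < length xs \<and> xs ! i \<le> t} \<subseteq> {..<m}"
        using assms(1) by (auto simp: not_le[symmetric] intro: order_trans[OF sorted_nth_mono])
      then have "card {i. i < length xs \<and> xs ! i \<le> t} \<le> card {..<m}"
        by (intro card_mono) auto
      then show False using * len by simp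
    qed
  qed
qed

text \<open>Turns the order statistic into a count, the form in which the quantile is used from here
  on. At rank 0 the value -\<infinity> makes both sides true.\<close>

lemma Quant_le_iff:
  assumes "0 < \<tau>" "\<tau> < 1"
  shows "Quant \<tau> A \<le> ereal t \<longleftrightarrow>
    nat \<lfloor>\<tau> * (real (size A) + 1)\<rfloor> \<le> size (filter_mset (\<lambda>a. a \<le> t) A)"
proof (cases "nat \<lfloor>\<tau> * (real (size A) + 1)\<rfloor>")
  case 0
  then show ?thesis by (simp add: Quant_def)
next
  case (Suc m)
  let ?xs = "sorted_list_of_multiset A"
  \<comment> \<open>Since \<open>\<tau> < 1\<close>, the rank \<open>Suc m\<close> stays below
    \<open>size A + 1\<close>, so \<open>m\<close> is a valid position in the sorted list.\<close>
  have "\<tau> * (real (size A) + 1) < 1 * (real (size A) + 1)"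
    using assms by (intro mult_strict_right_mono) auto
  then have "\<lfloor>\<tau> * (real (size A) + 1)\<rfloor> < int (size A) + 1" by (subst floor_less_iff) simp
  then have "m < size A" using Suc by linarith
  moreover have "size A = length ?xs"
    by (metis mset_sorted_list_of_multiset size_mset)
  moreover have "size (filter_mset (\<lambda>a. a \<le> t) A) = length (filter (\<lambda>a. a \<le> t) ?xs)"
    by (metis mset_sorted_list_of_multiset size_mset mset_filter)
  ultimately show ?thesis
    using Suc sorted_nth_le_iff[of ?xs m t] by (simp add: Quant_def)
qed

section \<open>Feasible labellings and the optimal quantile\<close>

lemma size_filter_scores:
  "size (filter_mset P (scores s n x z)) = card {i\<in>{1..n}. P (s (x i, z i))}"
  by (simp add: scores_def filter_mset_image_mset)

lemma finite_feasible_labels: "finite Y \<Longrightarrow> finite (feasible_labels Y n k yt)"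
  unfolding feasible_labels_def by (rule finite_subset[OF _ finite_PiE[of "{1..n}" "\<lambda>_. Y"]]) auto

lemma sum_of_bool_eq_card: "finite I \<Longrightarrow> (\<Sum>i\<in>I. of_bool (P i)) = card {i\<in>I. P i}"
  by (simp add: Int_def)

text \<open>A minimum over a finite nonempty set is at most \<open>t\<close> exactly when some
  member is. This trades the optimization for the existence of one labelling with enough low
  scores.\<close>

lemma q_lower_le_iff:
  assumes "finite Y" "0 < \<alpha>" "\<alpha> < 1" and ne: "feasible_labels Y n k yt \<noteq> {}"
  shows "q_lower s Y \<alpha> n k x yt \<le> ereal t \<longleftrightarrow>
    (\<exists>z\<in>feasible_labels Y n k yt.
      nat \<lfloor>\<alpha> * (real n + 1)\<rfloor> \<le> card {i\<in>{1..n}. s (x i, z i) \<le> t})"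
proof -
  have "size (scores s n x z) = n" for z by (simp add: scores_def)
  then show ?thesis
    unfolding q_lower_def
    using ne by (subst Min_le_iff)
      (auto simp: finite_feasible_labels assms Quant_le_iff size_filter_scores)
qed

text \<open>Used twice: with the clean labels as \<open>y\<close>, where the bound is the poisoning
  budget, and with \<open>y = yt\<close>, which shows that the feasible set is nonempty.\<close>

lemma restrict_in_feasible_labels:
  assumes "\<And>i. i \<in> {1..n} \<Longrightarrow> y i \<in> Y" "card {i\<in>{1..n}. yt i \<noteq> y i} \<le> k"
  shows "restrict y {1..n} \<in> feasible_labels Y n k yt"
proof -
  have "{i\<in>{1..n}. restrict y {1..n} i \<noteq> yt i} = {i\<in>{1..n}. yt i \<noteq> y i}" by auto
  then show ?thesis
    using assms unfolding feasible_labels_def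
    by (simp only: sum_of_bool_eq_card[OF finite_atLeastAtMost]) simp
qed

section \<open>Measurability of counts\<close>

lemma measurable_card_Collect:
  assumes "finite I" "\<And>i. i \<in> I \<Longrightarrow> Measurable.pred M (P i)"
  shows "(\<lambda>\<omega>. card {i\<in>I. P i \<omega>}) \<in> M \<rightarrow>\<^sub>M count_space UNIV"
proof -
  \<comment> \<open>The count is a finite sum of indicators, hence Borel; on the natural numbers the
    Borel sets are all sets, which gives measurability into \<open>count_space UNIV\<close>.\<close>
  have "(\<lambda>\<omega>. \<Sum>i\<in>I. of_bool (P i \<omega>) :: nat) \<in> borel_measurable M"
    using assms(2) unfolding of_bool_def by (intro borel_measurable_sum) measurable
  then show ?thesis
    unfolding sum_of_bool_eq_card[OF assms(1)] by 
      (simp add: measurable_cong_sets[OF refl sets_borel_eq_count_space])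
qed

lemma measurable_card_le:
  fixes f :: "'i \<Rightarrow> 'w \<Rightarrow> real"
  assumes "finite I" "\<And>i. i \<in> I \<Longrightarrow> f i \<in> borel_measurable M" "g \<in> borel_measurable M"
  shows "(\<lambda>\<omega>. card {i\<in>I. f i \<omega> \<le> g \<omega>}) \<in> M \<rightarrow>\<^sub>M count_space UNIV"
  using assms by (intro measurable_card_Collect) (auto simp: pred_def)

section \<open>Ranks under exchangeability\<close>

text \<open>Swapping \<open>j\<close> and \<open>l\<close> preserves the joint law, and a rank does
  not depend on the order in which the indices are listed.\<close>

lemma exchangeable_rank_prob_eq:
  fixes g :: "'a \<Rightarrow> real"
  assumes ex: "exchangeable M I S Z" and "finite I" and g: "g \<in> borel_measurable S"
    and j: "j \<in> I" and l: "l \<in> I"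
  shows "measure M {\<omega>\<in>space M. card {i\<in>I. g (Z i \<omega>) \<le> g (Z j \<omega>)} \<le> r} =
         measure M {\<omega>\<in>space M. card {i\<in>I. g (Z i \<omega>) \<le> g (Z l \<omega>)} \<le> r}"
proof -
  let ?P = "PiM I (\<lambda>_. S)"
  let ?D = "{f\<in>space ?P. card {i\<in>I. g (f i) \<le> g (f j)} \<le> r}"
  have Z: "Z i \<in> M \<rightarrow>\<^sub>M S" if "i \<in> I" for i using ex that by (auto simp: exchangeable_def)
  have gc: "(\<lambda>f. g (f i)) \<in> borel_measurable ?P" if "i \<in> I" for i
    using measurable_compose[OF measurable_component_singleton[OF that] g] .
  have D: "?D \<in> sets ?P"
  proof -
    have [measurable]: "(\<lambda>f. card {i\<in>I. g (f i) \<le> g (f j)}) \<in> ?P \<rightarrow>\<^sub>M count_space UNIV"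
      using gc j \<open>finite I\<close> by (intro measurable_card_le) auto
    show ?thesis by measurable
  qed
  \<comment> \<open>The event \<open>?D\<close> concerns coordinate \<open>j\<close>; pulled back
    along the tuple permuted by \<open>\<pi>\<close>, it concerns index \<open>\<pi> j\<close>. The
    transposition will give \<open>l\<close>, the identity \<open>j\<close>.\<close>
  have law: "measure (distr M ?P (\<lambda>\<omega>. \<lambda>i\<in>I. Z (\<pi> i) \<omega>)) ?D =
      measure M {\<omega>\<in>space M. card {i\<in>I. g (Z i \<omega>) \<le> g (Z (\<pi> j) \<omega>)} \<le> r}"
    if \<pi>: "\<pi> permutes I" for \<pi>
  proof -
    have Z\<pi>: "(\<lambda>\<omega>. \<lambda>i\<in>I. Z (\<pi> i) \<omega>) \<in> M \<rightarrow>\<^sub>M ?P"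
      using Z permutes_in_image[OF \<pi>] by (intro measurable_restrict) auto
    \<comment> \<open>Reindexing by \<open>\<pi>\<close> is a bijection between the two counted
      sets.\<close>
    have "card {i\<in>I. g (Z (\<pi> i) \<omega>) \<le> g (Z (\<pi> j) \<omega>)} = card {i\<in>I. g (Z i \<omega>) \<le> g (Z (\<pi> j) \<omega>)}"
      for \<omega>
    proof (rule bij_betw_same_card[of \<pi>])
      have "\<pi> ` {i\<in>I. g (Z (\<pi> i) \<omega>) \<le> g (Z (\<pi> j) \<omega>)} = {i\<in>I. g (Z i \<omega>) \<le> g (Z (\<pi> j) \<omega>)}"
      proof (intro equalityI subsetI)
        fix i assume i: "i \<in> {i\<in>I. g (Z i \<omega>) \<le> g (Z (\<pi> j) \<omega>)}"
        then obtain i' where "i' \<in> I" "i = \<pi> i'" using permutes_image[OF \<pi>] by blast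
        then show "i \<in> \<pi> ` {i\<in>I. g (Z (\<pi> i) \<omega>) \<le> g (Z (\<pi> j) \<omega>)}" using i by simp
      qed (auto simp: permutes_in_image[OF \<pi>])
      then show "bij_betw \<pi> {i\<in>I. g (Z (\<pi> i) \<omega>) \<le> g (Z (\<pi> j) \<omega>)}
          {i\<in>I. g (Z i \<omega>) \<le> g (Z (\<pi> j) \<omega>)}"
        by (simp add: bij_betw_def permutes_inj_on[OF \<pi>])
    qed
    moreover have "{i\<in>I. g ((\<lambda>i\<in>I. Z (\<pi> i) \<omega>) i) \<le> g ((\<lambda>i\<in>I. Z (\<pi> i) \<omega>) j)} =
        {i\<in>I. g (Z (\<pi> i) \<omega>) \<le> g (Z (\<pi> j) \<omega>)}" for \<omega>
      using j by (intro Collect_cong) simp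
    ultimately have "(\<lambda>i\<in>I. Z (\<pi> i) \<omega>) \<in> ?D \<longleftrightarrow> card {i\<in>I. g (Z i \<omega>) \<le> g (Z (\<pi> j) \<omega>)} \<le> r"
      if "\<omega> \<in> space M" for \<omega>
      using measurable_space[OF Z\<pi> that] by (simp only: mem_Collect_eq simp_thms)
    then have "(\<lambda>\<omega>. \<lambda>i\<in>I. Z (\<pi> i) \<omega>) -` ?D \<inter> space M =
        {\<omega>\<in>space M. card {i\<in>I. g (Z i \<omega>) \<le> g (Z (\<pi> j) \<omega>)} \<le> r}"
      by blast
    then show ?thesis using measure_distr[OF Z\<pi> D] by simp
  qed
  have "Transposition.transpose j l permutes I" using j l by (rule permutes_swap_id)
  then have "distr M ?P (\<lambda>\<omega>. \<lambda>i\<in>I. Z (Transposition.transpose j l i) \<omega>) = distr M ?P (\<lambda>\<omega>. \<lambda>i\<in>I. Z i \<omega>)"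
    using ex by (auto simp: exchangeable_def)
  then show ?thesis
    using law[OF \<open>Transposition.transpose j l permutes I\<close>] law[OF permutes_id] by simp
qed

text \<open>Double counting: as all indices are equally likely to have rank at most
  \<open>r\<close>, the left side is the expected number of such indices, and
  \<open>card_rank_le\<close> bounds that number pointwise by \<open>r\<close>.\<close>

lemma exchangeable_rank_prob_le:
  fixes g :: "'a \<Rightarrow> real"
  assumes "prob_space M" and ex: "exchangeable M I S Z" and "finite I"
    and g: "g \<in> borel_measurable S" and j: "j \<in> I"
  shows "real (card I) * measure M {\<omega>\<in>space M. card {i\<in>I. g (Z i \<omega>) \<le> g (Z j \<omega>)} \<le> r} \<le> real r"
proof -
  interpret prob_space M by fact
  let ?B = "\<lambda>l. {\<omega>\<in>space M. card {i\<in>I. g (Z i \<omega>) \<le> g (Z l \<omega>)} \<le> r}"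
  have gZ: "(\<lambda>\<omega>. g (Z i \<omega>)) \<in> borel_measurable M" if "i \<in> I" for i
    using ex that by (intro measurable_compose[OF _ g]) (auto simp: exchangeable_def)
  have B: "?B l \<in> sets M" if "l \<in> I" for l
  proof -
    have [measurable]: "(\<lambda>\<omega>. card {i\<in>I. g (Z i \<omega>) \<le> g (Z l \<omega>)}) \<in> M \<rightarrow>\<^sub>M count_space UNIV"
      using gZ that \<open>finite I\<close> by (intro measurable_card_le) auto
    show ?thesis by measurable
  qed
  have "real (card I) * prob (?B j) = (\<Sum>l\<in>I. prob (?B l))"
    using exchangeable_rank_prob_eq[OF ex \<open>finite I\<close> g _ j] by simp
  also have "\<dots> = (\<Sum>l\<in>I. expectation (indicator (?B l)))"
    using B by (intro sum.cong) auto
  also have "\<dots> = expectation (\<lambda>\<omega>. \<Sum>l\<in>I. indicator (?B l) \<omega>)"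
    using B by (intro Bochner_Integration.integral_sum[symmetric]) (auto simp: emeasure_eq_measure)
  also have "\<dots> \<le> expectation (\<lambda>\<omega>. real r)"
  proof (rule integral_mono)
    show "integrable M (\<lambda>\<omega>. \<Sum>l\<in>I. indicator (?B l) \<omega> :: real)"
      using B by (intro Bochner_Integration.integrable_sum) (auto simp: emeasure_eq_measure)
    fix \<omega> assume "\<omega> \<in> space M"
    then have "(\<Sum>l\<in>I. indicator (?B l) \<omega> :: real) =
        real (card {l\<in>I. card {i\<in>I. g (Z i \<omega>) \<le> g (Z l \<omega>)} \<le> r})"
      using \<open>finite I\<close> by (simp add: indicator_def Int_def)
    then show "(\<Sum>l\<in>I. indicator (?B l) \<omega>) \<le> real r"
      using card_rank_le[OF \<open>finite I\<close>, of "\<lambda>i. g (Z i \<omega>)" r] by simp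
  qed simp
  also have "\<dots> = real r" by (simp add: prob_space)
  finally show ?thesis .
qed

section \<open>Coverage under label poisoning\<close>

theorem mainTheorem3:
  fixes M :: "'w measure" and X :: "'x measure" and Y :: "'y set"
    and s :: "'x \<times> 'y \<Rightarrow> real"
    and x :: "nat \<Rightarrow> 'w \<Rightarrow> 'x" and y yt :: "nat \<Rightarrow> 'w \<Rightarrow> 'y"
    and \<alpha> :: real and n k :: nat
  assumes "prob_space M"
    and "finite Y"
    and "s \<in> borel_measurable (X \<Otimes>\<^sub>M count_space Y)"
    and "0 < \<alpha>" and "\<alpha> < 1"
    and "k \<le> n"
    and "exchangeable M {1..n+1} (X \<Otimes>\<^sub>M count_space Y) (\<lambda>i \<omega>. (x i \<omega>, y i \<omega>))"
    and "\<And>i. i \<in> {1..n} \<Longrightarrow> yt i \<in> M \<rightarrow>\<^sub>M count_space Y"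
    and "AE \<omega> in M. card {i \<in> {1..n}. yt i \<omega> \<noteq> y i \<omega>} \<le> k"
  shows "measure M {\<omega> \<in> space M.
           y (n+1) \<omega> \<in>
             prediction_set s Y (q_lower s Y \<alpha> n k (\<lambda>i. x i \<omega>) (\<lambda>i. yt i \<omega>)) (x (n+1) \<omega>)}
         \<ge> 1 - \<alpha>"
proof -
  interpret prob_space M by fact
  let ?S = "X \<Otimes>\<^sub>M count_space Y"
  let ?Z = "\<lambda>i \<omega>. (x i \<omega>, y i \<omega>)"
  let ?t = "\<lambda>\<omega>. s (x (n+1) \<omega>, y (n+1) \<omega>)"
  let ?F = "\<lambda>\<omega>. feasible_labels Y n k (\<lambda>i. yt i \<omega>)"
  define r where "r = nat \<lfloor>\<alpha> * (real n + 1)\<rfloor>"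
  let ?E = "{\<omega>\<in>space M. y (n+1) \<omega> \<in>
    prediction_set s Y (q_lower s Y \<alpha> n k (\<lambda>i. x i \<omega>) (\<lambda>i. yt i \<omega>)) (x (n+1) \<omega>)}"
  \<comment> \<open>The test score counts itself here, so outside \<open>?bad\<close> at least
    \<open>r\<close> of the \<open>n\<close> calibration scores are at most the test score.\<close>
  let ?bad = "{\<omega>\<in>space M. card {i\<in>{1..n+1}. s (?Z i \<omega>) \<le> ?t \<omega>} \<le> r}"
  note s [measurable] = assms(3)
  have Z: "?Z i \<in> M \<rightarrow>\<^sub>M ?S" if "i \<in> {1..n+1}" for i
    using assms(7) that by (auto simp: exchangeable_def)
  have x: "x i \<in> M \<rightarrow>\<^sub>M X" and y: "y i \<in> M \<rightarrow>\<^sub>M count_space Y" if "i \<in> {1..n+1}" for i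
    using measurable_compose[OF Z[OF that] measurable_fst]
      measurable_compose[OF Z[OF that] measurable_snd] by auto
  have yY: "y i \<omega> \<in> Y" if "i \<in> {1..n+1}" "\<omega> \<in> space M" for i \<omega>
    using measurable_space[OF y[OF that(1)] that(2)] by simp
  have sx: "(\<lambda>\<omega>. s (x i \<omega>, c)) \<in> borel_measurable M" if "i \<in> {1..n+1}" "c \<in> Y" for i c
    using x[OF that(1)] that(2) by (intro measurable_compose[OF _ s]) simp
  have sZ: "(\<lambda>\<omega>. s (?Z i \<omega>)) \<in> borel_measurable M" if "i \<in> {1..n+1}" for i
    using measurable_compose[OF Z[OF that] s] .
  have bad: "?bad \<in> sets M"
  proof -
    have [measurable]: "(\<lambda>\<omega>. card {i\<in>{1..n+1}. s (?Z i \<omega>) \<le> ?t \<omega>}) \<in> M \<rightarrow>\<^sub>M count_space UNIV"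
      using sZ by (intro measurable_card_le) auto
    show ?thesis by measurable
  qed
  have ytY: "yt i \<omega> \<in> Y" if "i \<in> {1..n}" "\<omega> \<in> space M" for i \<omega>
    using measurable_space[OF assms(8)[OF that(1)] that(2)] by simp
  \<comment> \<open>The poisoned labels themselves are feasible, with no change spent.\<close>
  have ne: "?F \<omega> \<noteq> {}" if "\<omega> \<in> space M" for \<omega>
    using restrict_in_feasible_labels[of n "\<lambda>i. yt i \<omega>" Y "\<lambda>i. yt i \<omega>" k] ytY that by auto
  have E_iff: "\<omega> \<in> ?E \<longleftrightarrow> (\<exists>z\<in>?F \<omega>. r \<le> card {i\<in>{1..n}. s (x i \<omega>, z i) \<le> ?t \<omega>})"
    if "\<omega> \<in> space M" for \<omega>
    using q_lower_le_iff[OF assms(2,4,5) ne[OF that]] yY[OF _ that] that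
    by (simp add: prediction_set_def r_def)
  \<comment> \<open>The feasible set depends on \<open>\<omega>\<close>. For measurability of
    \<open>?E\<close> the budget is moved into the event, leaving a union over the fixed finite set
    of all labellings.\<close>
  have "?E = (\<Union>z\<in>{1..n} \<rightarrow>\<^sub>E Y. {\<omega>\<in>space M. card {i\<in>{1..n}. z i \<noteq> yt i \<omega>} \<le> k \<and>
      r \<le> card {i\<in>{1..n}. s (x i \<omega>, z i) \<le> ?t \<omega>}})" (is "_ = (\<Union>z\<in>_. ?G z)")
  proof (rule set_eqI)
    fix \<omega>
    show "\<omega> \<in> ?E \<longleftrightarrow> \<omega> \<in> (\<Union>z\<in>{1..n} \<rightarrow>\<^sub>E Y. ?G z)"
    proof (cases "\<omega> \<in> space M")
      case True
      show ?thesis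
        unfolding E_iff[OF True]
        using True by (auto simp: feasible_labels_def sum_of_bool_eq_card simp del: sum_of_bool_eq)
    qed auto
  qed
  also have "\<dots> \<in> sets M"
  proof (intro sets.finite_UN finite_PiE)
    fix z assume z: "z \<in> {1..n} \<rightarrow>\<^sub>E Y"
    have [measurable]: "(\<lambda>\<omega>. card {i\<in>{1..n}. s (x i \<omega>, z i) \<le> ?t \<omega>}) \<in> M \<rightarrow>\<^sub>M count_space UNIV"
      using sx sZ PiE_mem[OF z] by (intro measurable_card_le) auto
    have "Measurable.pred M (\<lambda>\<omega>. z i \<noteq> yt i \<omega>)" if "i \<in> {1..n}" for i
      using measurable_compose[OF assms(8)[OF that], of "\<lambda>c. z i \<noteq> c" "count_space UNIV"] by simp
    then have [measurable]: "(\<lambda>\<omega>. card {i\<in>{1..n}. z i \<noteq> yt i \<omega>}) \<in> M \<rightarrow>\<^sub>M count_space UNIV"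
      by (intro measurable_card_Collect) auto
    show "?G z \<in> sets M" by measurable
  qed (use assms(2) in auto)
  finally have E: "?E \<in> sets M" .
  \<comment> \<open>The witness in \<open>E_iff\<close> is the clean labelling, which is feasible
    wherever the budget holds, that is, almost surely.\<close>
  have good: "AE \<omega> in M. \<omega> \<in> space M - ?bad \<longrightarrow> \<omega> \<in> ?E"
    using assms(9)
  proof eventually_elim
    case (elim \<omega>)
    show ?case
    proof
      assume \<omega>: "\<omega> \<in> space M - ?bad"
      have "{i\<in>{1..n+1}. s (?Z i \<omega>) \<le> ?t \<omega>} = insert (n+1) {i\<in>{1..n}. s (?Z i \<omega>) \<le> ?t \<omega>}"
        by auto
      then have "card {i\<in>{1..n+1}. s (?Z i \<omega>) \<le> ?t \<omega>} = Suc (card {i\<in>{1..n}. s (?Z i \<omega>) \<le> ?t \<omega>})"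
        by simp
      moreover have "\<not> card {i\<in>{1..n+1}. s (?Z i \<omega>) \<le> ?t \<omega>} \<le> r"
        using \<omega> by blast
      ultimately have "r \<le> card {i\<in>{1..n}. s (?Z i \<omega>) \<le> ?t \<omega>}"
        by linarith
      also have "{i\<in>{1..n}. s (?Z i \<omega>) \<le> ?t \<omega>} =
          {i\<in>{1..n}. s (x i \<omega>, restrict (\<lambda>i. y i \<omega>) {1..n} i) \<le> ?t \<omega>}"
        by auto
      finally have "r \<le> card {i\<in>{1..n}. s (x i \<omega>, restrict (\<lambda>i. y i \<omega>) {1..n} i) \<le> ?t \<omega>}" .
      moreover have "restrict (\<lambda>i. y i \<omega>) {1..n} \<in> ?F \<omega>"
        using elim yY \<omega> by (intro restrict_in_feasible_labels) auto
      ultimately show "\<omega> \<in> ?E"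
        by (intro iffD2[OF E_iff[OF DiffD1[OF \<omega>]]] bexI)
    qed
  qed
  have "real (n + 1) * prob ?bad \<le> real r"
    using exchangeable_rank_prob_le[OF assms(1,7) finite_atLeastAtMost s, of "n+1" r] by simp
  \<comment> \<open>Here the factor \<open>n + 1\<close> in the definition of the rank cancels the
    number of exchangeable indices. As \<open>\<alpha> > 0\<close>, \<open>nat\<close> leaves the
    floor unchanged.\<close>
  also have "\<dots> \<le> real (n + 1) * \<alpha>"
    using assms(4) by (simp add: r_def mult.commute add.commute)
  finally have "prob ?bad \<le> \<alpha>" by simp
  then have "1 - \<alpha> \<le> prob (space M - ?bad)"
    using prob_compl[OF bad] by simp
  also have "\<dots> \<le> prob ?E"
    by (rule finite_measure_mono_AE[OF good E])
  finally show ?thesis .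
qed

end
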